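(* Let $n\ge 2$, let $G$ be a (not necessarily commutative) group of order $4n-1$, written additively, and let $D\subseteq G$ be a Paley-type difference set, i.e. a $(4n-1,2n-1,n-1)$ difference set in $G$. Then $D^2\cup(\overline{D})^{2-}\subseteq G^2$ is a difference set of propriety $3$ with parameters $$\big(4n-1,\ (4n-1)(2n-1),\ (4n-1)(n-1)\big).$$
   Context: A $(v,k,\lambda)$ difference set in a group $G$ of order $v$ is a subset $D\subseteq G$ with $|D|=k$ such that for every $g\in G\setminus\{0\}$ there are exactly $\lambda$ choices of $x,x'\in D$ with $x-x'=g$. Notation: $\overline{D}=G\setminus D$, $D^2=D\times D$, and for $E\subseteq G$, $E^{2-}=(E\times E)\setminus\{(x,x)\mid x\in E\}$. A set $P\subseteq G^2$ with $|P|=K$ is a $(v,K,\Lambda)$ difference set of propriety $3$ if for every $g\in G\setminus\{0\}$: 1. there are exactly $\Lambda$ choices of $(x,y),(x',y')\in P$ with $-x+x'=-y+y'=g$; 2. there are exactly $\Lambda$ choices of $(x,y),(x',y')\in P$ with $x-x'=g$ and $y=y'$; 3. there are exactly $\Lambda$ choices of $(x,y),(x',y')\in P$ with $x=x'$ and $y-y'=g$. *)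

theory Defs
  imports "HOL-Algebra.Coset"
begin

text \<open>
  Groups are those of HOL-Algebra, hence written multiplicatively: the additive \<open>x - x'\<close>,
  \<open>-x + x'\<close> and \<open>0\<close> (for a not necessarily commutative group) are rendered as
  \<open>x \<otimes> inv x'\<close>, \<open>inv x \<otimes> x'\<close> and \<open>\<one>\<close>. Choices of pairs are ordered, and finiteness of the
  carrier is explicit because \<open>order\<close> is \<open>0\<close> on infinite carriers.
\<close>

definition difference_set ::
  "('a, 'b) monoid_scheme \<Rightarrow> nat \<Rightarrow> nat \<Rightarrow> nat \<Rightarrow> 'a set \<Rightarrow> bool" where
  "difference_set G v k l D \<longleftrightarrow>
     group G \<and> finite (carrier G) \<and> order G = v \<and>
     D \<subseteq> carrier G \<and> card D = k \<and>
     (\<forall>g \<in> carrier G - {\<one>\<^bsub>G\<^esub>}.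
        card {(x, x'). x \<in> D \<and> x' \<in> D \<and> x \<otimes>\<^bsub>G\<^esub> inv\<^bsub>G\<^esub> x' = g} = l)"

definition paley_type ::
  "('a, 'b) monoid_scheme \<Rightarrow> nat \<Rightarrow> 'a set \<Rightarrow> bool" where
  "paley_type G n D \<longleftrightarrow> difference_set G (4 * n - 1) (2 * n - 1) (n - 1) D"

definition difference_set_propriety_3 ::
  "('a, 'b) monoid_scheme \<Rightarrow> nat \<Rightarrow> nat \<Rightarrow> nat \<Rightarrow> ('a \<times> 'a) set \<Rightarrow> bool" where
  "difference_set_propriety_3 G v K L P \<longleftrightarrow>
     group G \<and> finite (carrier G) \<and> order G = v \<and>
     P \<subseteq> carrier G \<times> carrier G \<and> card P = K \<and>
     (\<forall>g \<in> carrier G - {\<one>\<^bsub>G\<^esub>}.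
        card {((x, y), (x', y')). (x, y) \<in> P \<and> (x', y') \<in> P \<and>
                inv\<^bsub>G\<^esub> x \<otimes>\<^bsub>G\<^esub> x' = g \<and> inv\<^bsub>G\<^esub> y \<otimes>\<^bsub>G\<^esub> y' = g} = L \<and>
        card {((x, y), (x', y')). (x, y) \<in> P \<and> (x', y') \<in> P \<and>
                x \<otimes>\<^bsub>G\<^esub> inv\<^bsub>G\<^esub> x' = g \<and> y = y'} = L \<and>
        card {((x, y), (x', y')). (x, y) \<in> P \<and> (x', y') \<in> P \<and>
                x = x' \<and> y \<otimes>\<^bsub>G\<^esub> inv\<^bsub>G\<^esub> y' = g} = L)"

definition off_diagonal :: "'a set \<Rightarrow> ('a \<times> 'a) set" where
  "off_diagonal E = (E \<times> E) - {(x, x) | x. x \<in> E}"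

end

theory Submission
  imports Defs
begin

text \<open>
  Each of the three conditions counts the points of \<open>P = D\<^sup>2 \<union> (V - D)\<^sup>2\<^sup>-\<close> that a fixed-point-free
  permutation \<open>\<sigma>\<close> of \<open>V\<close>, acting on both coordinates or on one of them, keeps inside \<open>P\<close>; here
  \<open>\<sigma>\<close> is a right or a left translation.  Both counts depend only on the number of \<open>x \<in> D\<close> with
  \<open>\<sigma> x \<in> D\<close>.  For left translations this number is given.  For right translations it is obtained
  by a variance argument: the numbers \<open>r g\<close> and \<open>l g\<close> of representations of \<open>g\<close> as \<open>- x + x'\<close>
  and as \<open>x - x'\<close> have equal sums and equal sums of squares (\<open>- x + x' = - y + y'\<close> iff
  \<open>y - x = y' - x'\<close>), so that \<open>l\<close> being constantly \<open>\<lambda>\<close> off the identity forces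
  \<open>\<Sum> (r g - \<lambda>)\<^sup>2 = 0\<close>.
\<close>

section \<open>First and second moments of fibre sizes\<close>

lemma sum_card_fibres_square:
  assumes "finite S" "finite T" "f ` S \<subseteq> T"
  shows "(\<Sum>t\<in>T. (card {p \<in> S. f p = t})\<^sup>2) = card {(p, q). p \<in> S \<and> q \<in> S \<and> f p = f q}"
proof -
  \<comment> \<open>The second moment counts collisions of \<open>f\<close>. Two maps can therefore
    be compared by a bijection between their collision sets, without matching individual
    fibres.\<close>
  have "{(p, q). p \<in> S \<and> q \<in> S \<and> f p = f q} = (SIGMA p:S. {q \<in> S. f q = f p})"
    by auto
  then have "card {(p, q). p \<in> S \<and> q \<in> S \<and> f p = f q} = (\<Sum>p\<in>S. card {q \<in> S. f q = f p})"
    using assms(1) by simp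
  also have "\<dots> = (\<Sum>t\<in>T. \<Sum>p\<in>{p \<in> S. f p = t}. card {q \<in> S. f q = f p})"
    by (rule sum.group[OF assms, symmetric])
  also have "\<dots> = (\<Sum>t\<in>T. (card {p \<in> S. f p = t})\<^sup>2)"
    by (simp add: power2_eq_square)
  finally show ?thesis by simp
qed

lemma sum_card_fibres:
  assumes "finite S" "finite T" "f ` S \<subseteq> T"
  shows "(\<Sum>t\<in>T. card {p \<in> S. f p = t}) = card S"
  using sum.group[OF assms, of "\<lambda>_. 1 :: nat"] by simp

text \<open>For fixed \<open>c\<close> and \<open>T\<close>, the sum of
  \<open>(h t - c)\<^sup>2\<close> depends only on the first two moments of \<open>h\<close>. It is
  therefore the same for \<open>r\<close> as for \<open>l\<close>, hence zero, and each square
  vanishes. Integer values keep the subtraction exact.\<close>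

lemma eq_const_of_sums_eq:
  fixes l r :: "'a \<Rightarrow> int"
  assumes "finite T"
    and "sum r T = sum l T" "(\<Sum>t\<in>T. (r t)\<^sup>2) = (\<Sum>t\<in>T. (l t)\<^sup>2)"
    and "\<And>t. t \<in> T \<Longrightarrow> l t = c" and "t \<in> T"
  shows "r t = c"
proof -
  have expand: "(\<Sum>t\<in>T. (h t - c)\<^sup>2) = (\<Sum>t\<in>T. (h t)\<^sup>2) - 2 * c * sum h T + (\<Sum>t\<in>T. c\<^sup>2)"
    for h :: "'a \<Rightarrow> int"
    by (simp add: power2_diff sum.distrib sum_subtractf mult_ac flip: sum_distrib_left sum_distrib_right)
  have "(\<Sum>t\<in>T. (r t - c)\<^sup>2) = (\<Sum>t\<in>T. (l t - c)\<^sup>2)"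
    using assms(2,3) by (simp only: expand)
  also have "\<dots> = 0"
    using assms(4) by simp
  finally have "(\<Sum>t\<in>T. (r t - c)\<^sup>2) = 0" .
  then show ?thesis
    using assms(1,5) by (simp add: sum_nonneg_eq_0_iff)
qed

section \<open>Passing from quotients \<open>x \<otimes> inv x'\<close> to quotients
  \<open>inv x \<otimes> x'\<close>\<close>

lemma (in group) inv_mult_eq_iff_mult_inv_eq:
  assumes "x \<in> carrier G" "x' \<in> carrier G" "y \<in> carrier G" "y' \<in> carrier G"
  shows "inv x \<otimes> x' = inv y \<otimes> y' \<longleftrightarrow> y \<otimes> inv x = y' \<otimes> inv x'"
proof -
  \<comment> \<open>Both equations are rearrangements of
    \<open>y \<otimes> inv x \<otimes> x' = y'\<close>.\<close>
  have "inv x \<otimes> x' = inv y \<otimes> y' \<longleftrightarrow> y \<otimes> (inv x \<otimes> x') = y'"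
    using assms by (metis inv_closed inv_solve_left m_closed)
  also have "\<dots> \<longleftrightarrow> y \<otimes> inv x \<otimes> x' = y'"
    using assms by (simp add: m_assoc)
  also have "\<dots> \<longleftrightarrow> y \<otimes> inv x = y' \<otimes> inv x'"
    using assms by (metis inv_closed inv_solve_right m_closed)
  finally show ?thesis .
qed

lemma (in group) inv_mult_eq_one_iff:
  assumes "x \<in> carrier G" "y \<in> carrier G"
  shows "inv x \<otimes> y = \<one> \<longleftrightarrow> x = y"
  using assms by (metis inv_closed inv_equality inv_inv l_inv)

lemma (in group) mult_inv_eq_one_iff:
  assumes "x \<in> carrier G" "y \<in> carrier G"
  shows "x \<otimes> inv y = \<one> \<longleftrightarrow> x = y"
  using assms by (metis inv_closed inv_equality inv_inv r_inv)

text \<open>Equivalently, the set of inverses of \<open>D\<close> is a difference set with the same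
  parameters. In a noncommutative group this is not immediate from the definition; it comes from
  comparing moments.\<close>

lemma difference_set_left_quotients:
  fixes G (structure)
  assumes ds: "difference_set G v k l D" and g: "g \<in> carrier G" "g \<noteq> \<one>"
  shows "card {p \<in> D \<times> D. inv (fst p) \<otimes> snd p = g} = l"
proof -
  interpret group G using ds by (simp add: difference_set_def)
  define L where "L p = fst p \<otimes> inv (snd p)" for p
  define R where "R p = inv (fst p) \<otimes> snd p" for p
  define cl where "cl t = card {p \<in> D \<times> D. L p = t}" for t
  define cr where "cr t = card {p \<in> D \<times> D. R p = t}" for t
  have fin: "finite (carrier G)" and D: "D \<subseteq> carrier G"
    and "\<forall>g \<in> carrier G - {\<one>}. card {(x, x'). x \<in> D \<and> x' \<in> D \<and> x \<otimes> inv x' = g} = l"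
    using ds by (auto simp: difference_set_def)
  moreover have "{(x, x'). x \<in> D \<and> x' \<in> D \<and> x \<otimes> inv x' = t} = {p \<in> D \<times> D. L p = t}" for t
    by (auto simp: L_def)
  ultimately have cl: "cl t = l" if "t \<in> carrier G - {\<one>}" for t
    using that by (simp add: cl_def)
  have finD: "finite (D \<times> D)"
    using fin D by (simp add: finite_subset)
  have LT: "L ` (D \<times> D) \<subseteq> carrier G" and RT: "R ` (D \<times> D) \<subseteq> carrier G"
    using D by (auto simp: L_def R_def subset_iff)
  \<comment> \<open>Both fibres over the identity are the diagonal of \<open>D\<close>. Since
    \<open>cl\<close> is known to be \<open>l\<close> only off the identity, this common term has to
    be removed from both moments before the variance argument applies.\<close>
  have "{p \<in> D \<times> D. L p = \<one>} = {p \<in> D \<times> D. R p = \<one>}"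
    using D by (auto simp: L_def R_def mult_inv_eq_one_iff inv_mult_eq_one_iff subset_iff)
  then have one: "cr \<one> = cl \<one>"
    by (simp add: cl_def cr_def)
  have sum: "sum cr (carrier G) = sum cl (carrier G)"
    unfolding cl_def cr_def sum_card_fibres[OF finD fin LT] sum_card_fibres[OF finD fin RT] ..
  \<comment> \<open>Re-pairing the four entries turns a collision of \<open>R\<close> into a
    collision of \<open>L\<close>, by \<open>inv_mult_eq_iff_mult_inv_eq\<close>.\<close>
  have "bij_betw (\<lambda>((x, x'), (y, y')). ((y, x), (y', x')))
     {(p, q). p \<in> D \<times> D \<and> q \<in> D \<times> D \<and> R p = R q}
     {(p, q). p \<in> D \<times> D \<and> q \<in> D \<times> D \<and> L p = L q}"
    by (rule bij_betw_byWitness[where f' = "\<lambda>((y, x), (y', x')). ((x, x'), (y, y'))"])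
      (use D in \<open>auto simp: L_def R_def inv_mult_eq_iff_mult_inv_eq subset_iff\<close>)
  then have sq: "(\<Sum>t\<in>carrier G. (cr t)\<^sup>2) = (\<Sum>t\<in>carrier G. (cl t)\<^sup>2)"
    unfolding cl_def cr_def sum_card_fibres_square[OF finD fin LT]
      sum_card_fibres_square[OF finD fin RT]
    by (rule bij_betw_same_card)
  have "int (cr g) = int l"
  proof (rule eq_const_of_sums_eq[where T = "carrier G - {\<one>}" and l = "\<lambda>t. int (cl t)"])
    show "(\<Sum>t\<in>carrier G - {\<one>}. int (cr t)) = (\<Sum>t\<in>carrier G - {\<one>}. int (cl t))"
      using sum one fin by (simp add: sum.remove[where x = "\<one>"] flip: of_nat_sum)
    show "(\<Sum>t\<in>carrier G - {\<one>}. (int (cr t))\<^sup>2) = (\<Sum>t\<in>carrier G - {\<one>}. (int (cl t))\<^sup>2)"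
      using sq one fin by (simp add: sum.remove[where x = "\<one>"] flip: of_nat_sum of_nat_power)
  qed (use fin cl g in auto)
  then show ?thesis
    by (simp add: cr_def R_def)
qed

section \<open>Sizes of \<open>P\<close> and of the part of \<open>P\<close> that a shift keeps
  inside \<open>P\<close>\<close>

lemma off_diagonal_eq: "off_diagonal E = {(x, y). x \<in> E \<and> y \<in> E \<and> x \<noteq> y}"
  by (auto simp: off_diagonal_def)

lemma finite_off_diagonal: "finite E \<Longrightarrow> finite (off_diagonal E)"
  by (simp add: off_diagonal_def)

lemma card_off_diagonal:
  assumes "finite E"
  shows "card (off_diagonal E) = card E * (card E - 1)"
proof -
  have "card {(x, x) | x. x \<in> E} = card E"
    using card_image[of "\<lambda>x. (x, x)" E] by (simp add: inj_on_def Setcompr_eq_image)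
  moreover have "{(x, x) | x. x \<in> E} \<subseteq> E \<times> E"
    by auto
  ultimately show ?thesis
    unfolding off_diagonal_def using assms
    by (subst card_Diff_subset) (auto simp: card_cartesian_product diff_mult_distrib2 intro: finite_subset)
qed

lemma card_square_Un_off_diagonal:
  assumes "finite V" "D \<subseteq> V"
  shows "card (D \<times> D \<union> off_diagonal (V - D)) =
    card D * card D + (card V - card D) * (card V - card D - 1)"
proof -
  have "finite D"
    using assms finite_subset by blast
  moreover have "(D \<times> D) \<inter> off_diagonal (V - D) = {}"
    by (auto simp: off_diagonal_eq)
  ultimately show ?thesis
    using assms
    by (simp add: card_Un_disjoint finite_off_diagonal card_off_diagonal card_cartesian_product
        card_Diff_subset)
qed

text \<open>With the group forgotten, one count serves right and left translations alike. Here
  \<open>m\<close> stands for \<open>n - 1\<close>, which frees the parameters from truncated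
  subtraction.\<close>

locale shifted_paley_set =
  fixes V D :: "'a set" and m :: nat and \<sigma> :: "'a \<Rightarrow> 'a"
  assumes finite_V: "finite V" and card_V: "card V = 4 * m + 3"
    and D_subset: "D \<subseteq> V" and card_D: "card D = 2 * m + 1"
    and bij: "bij_betw \<sigma> V V" and no_fixpoint: "x \<in> V \<Longrightarrow> \<sigma> x \<noteq> x"
    and card_D_D: "card {x \<in> D. \<sigma> x \<in> D} = m"
begin

abbreviation "P \<equiv> D \<times> D \<union> off_diagonal (V - D)"

lemma maps_to: "x \<in> V \<Longrightarrow> \<sigma> x \<in> V"
  using bij by (auto simp: bij_betw_def)

lemma inj: "x \<in> V \<Longrightarrow> y \<in> V \<Longrightarrow> \<sigma> x = \<sigma> y \<longleftrightarrow> x = y"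
  using bij by (auto simp: bij_betw_def inj_on_def)

lemma finite_D: "finite D"
  using finite_V D_subset finite_subset by blast

lemma card_D_E: "card {x \<in> D. \<sigma> x \<notin> D} = m + 1"
proof -
  have "card D = card ({x \<in> D. \<sigma> x \<in> D} \<union> {x \<in> D. \<sigma> x \<notin> D})"
    by (rule arg_cong[where f = card]) auto
  also have "\<dots> = card {x \<in> D. \<sigma> x \<in> D} + card {x \<in> D. \<sigma> x \<notin> D}"
    using finite_D by (intro card_Un_disjoint) auto
  finally show ?thesis
    by (simp add: card_D card_D_D)
qed

text \<open>The preimage of \<open>D\<close> under the permutation has \<open>2 * m + 1\<close>
  points, of which \<open>m\<close> lie in \<open>D\<close>.\<close>

lemma card_E_D: "card {x \<in> V - D. \<sigma> x \<in> D} = m + 1"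
proof -
  have "bij_betw \<sigma> {x \<in> V. \<sigma> x \<in> D} D"
    using bij D_subset by (auto simp: bij_betw_def inj_on_def)
  then have "card D = card {x \<in> V. \<sigma> x \<in> D}"
    by (rule bij_betw_same_card[symmetric])
  also have "\<dots> = card ({x \<in> D. \<sigma> x \<in> D} \<union> {x \<in> V - D. \<sigma> x \<in> D})"
    using D_subset by (intro arg_cong[where f = card]) auto
  also have "\<dots> = card {x \<in> D. \<sigma> x \<in> D} + card {x \<in> V - D. \<sigma> x \<in> D}"
    using finite_D finite_V by (intro card_Un_disjoint) auto
  finally show ?thesis
    by (simp add: card_D card_D_D)
qed

lemma card_E: "card (V - D) = 2 * m + 2"
  using finite_D D_subset by (simp add: card_Diff_subset card_V card_D)

lemma card_E_E: "card {x \<in> V - D. \<sigma> x \<notin> D} = m + 1"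
proof -
  have "card (V - D) = card ({x \<in> V - D. \<sigma> x \<in> D} \<union> {x \<in> V - D. \<sigma> x \<notin> D})"
    by (rule arg_cong[where f = card]) auto
  also have "\<dots> = card {x \<in> V - D. \<sigma> x \<in> D} + card {x \<in> V - D. \<sigma> x \<notin> D}"
    using finite_V by (intro card_Un_disjoint) auto
  finally show ?thesis
    unfolding card_E card_E_D by simp
qed

text \<open>Sort points by the sides on which \<open>x\<close> and \<open>\<sigma> x\<close> lie. A
  pair counts iff both entries are in the same class and, unless that class is \<open>?A\<close>,
  are distinct: outside \<open>?A\<close> the pair or its image lies off \<open>D\<close>, and
  \<open>\<sigma>\<close> is injective. The total is \<open>m * m + 3 * (m + 1) * m\<close>.\<close>

lemma card_shift_both: "card {(x, y) \<in> P. (\<sigma> x, \<sigma> y) \<in> P} = (4 * m + 3) * m"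
proof -
  let ?A = "{x \<in> D. \<sigma> x \<in> D}" and ?B = "{x \<in> D. \<sigma> x \<notin> D}"
  let ?C = "{x \<in> V - D. \<sigma> x \<in> D}" and ?F = "{x \<in> V - D. \<sigma> x \<notin> D}"
  have split: "{(x, y) \<in> P. (\<sigma> x, \<sigma> y) \<in> P} =
      ?A \<times> ?A \<union> (off_diagonal ?B \<union> (off_diagonal ?C \<union> off_diagonal ?F))"
    using D_subset by (auto simp: off_diagonal_eq inj maps_to subset_iff)
  have fin: "finite ?A" "finite ?B" "finite ?C" "finite ?F"
    using finite_D finite_V by auto
  have disj: "off_diagonal ?C \<inter> off_diagonal ?F = {}"
    "off_diagonal ?B \<inter> (off_diagonal ?C \<union> off_diagonal ?F) = {}"
    "?A \<times> ?A \<inter> (off_diagonal ?B \<union> (off_diagonal ?C \<union> off_diagonal ?F)) = {}"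
    by (auto simp: off_diagonal_eq)
  have "card {(x, y) \<in> P. (\<sigma> x, \<sigma> y) \<in> P} =
      card (?A \<times> ?A) + (card (off_diagonal ?B) + (card (off_diagonal ?C) + card (off_diagonal ?F)))"
    unfolding split by (simp only: card_Un_disjoint disj fin finite_off_diagonal finite_UnI finite_SigmaI)
  also have "\<dots> = (4 * m + 3) * m"
    unfolding card_cartesian_product card_off_diagonal[OF fin(2)] card_off_diagonal[OF fin(3)]
      card_off_diagonal[OF fin(4)] card_D_D card_D_E card_E_D card_E_E
    by (simp add: algebra_simps)
  finally show ?thesis .
qed

text \<open>The fixed \<open>y\<close> forces \<open>x\<close> and \<open>\<sigma> x\<close> onto
  its own side. Inside \<open>D\<close> this gives \<open>m * (2 * m + 1)\<close> pairs. Outside,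
  \<open>y\<close> must also avoid both \<open>x\<close> and \<open>\<sigma> x\<close>: the graphs
  \<open>?I\<close> and \<open>?S\<close> are removed, and they are disjoint because
  \<open>\<sigma>\<close> has no fixed point. This leaves \<open>m * (2 * m + 2)\<close>
  pairs.\<close>

lemma card_shift_fst: "card {(x, y) \<in> P. (\<sigma> x, y) \<in> P} = (4 * m + 3) * m"
proof -
  let ?A = "{x \<in> D. \<sigma> x \<in> D}" and ?F = "{x \<in> V - D. \<sigma> x \<notin> D}"
  let ?I = "(\<lambda>x. (x, x)) ` ?F" and ?S = "(\<lambda>x. (x, \<sigma> x)) ` ?F"
  have split: "{(x, y) \<in> P. (\<sigma> x, y) \<in> P} = ?A \<times> D \<union> (?F \<times> (V - D) - (?I \<union> ?S))"
    using D_subset by (auto simp: off_diagonal_eq maps_to subset_iff)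
  have "card (?I \<union> ?S) = card ?I + card ?S"
    using finite_V no_fixpoint by (intro card_Un_disjoint) fastforce+
  also have "\<dots> = 2 * m + 2"
    using card_E_E by (subst (1 2) card_image) (auto simp: inj_on_def)
  finally have IS: "card (?I \<union> ?S) = 2 * m + 2" .
  have "card (?F \<times> (V - D) - (?I \<union> ?S)) = card (?F \<times> (V - D)) - card (?I \<union> ?S)"
    using finite_V maps_to by (intro card_Diff_subset) auto
  also have "\<dots> = (m + 1) * (2 * m + 2) - (2 * m + 2)"
    by (simp only: card_cartesian_product card_E_E card_E IS)
  finally have "card (?F \<times> (V - D) - (?I \<union> ?S)) = m * (2 * m + 2)"
    by simp
  moreover have "card (?A \<times> D \<union> (?F \<times> (V - D) - (?I \<union> ?S))) =
      card (?A \<times> D) + card (?F \<times> (V - D) - (?I \<union> ?S))"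
    using finite_D finite_V by (intro card_Un_disjoint) auto
  ultimately show ?thesis
    unfolding split by (simp add: card_cartesian_product card_D card_D_D algebra_simps)
qed

text \<open>\<open>P\<close> is symmetric under exchange of coordinates.\<close>

lemma card_shift_snd: "card {(x, y) \<in> P. (x, \<sigma> y) \<in> P} = (4 * m + 3) * m"
proof -
  have "bij_betw prod.swap {(x, y) \<in> P. (x, \<sigma> y) \<in> P} {(x, y) \<in> P. (\<sigma> x, y) \<in> P}"
    by (rule bij_betw_byWitness[where f' = prod.swap]) (auto simp: off_diagonal_eq)
  from bij_betw_same_card[OF this] card_shift_fst show ?thesis
    by (rule trans)
qed

end

section \<open>The three conditions as shifts by group translations\<close>

theorem theorem3p13:
  fixes G :: "('a, 'b) monoid_scheme" and n :: nat and D :: "'a set"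
  assumes "n \<ge> 2"
    and "group G" and "order G = 4 * n - 1"
    and "paley_type G n D"
  shows "difference_set_propriety_3 G (4 * n - 1) ((4 * n - 1) * (2 * n - 1)) ((4 * n - 1) * (n - 1))
           (D \<times> D \<union> off_diagonal (carrier G - D))"
proof -
  interpret group G by fact
  obtain m where n: "n = m + 1"
    using assms(1) that[of "n - 1"] by simp
  have ds: "difference_set G (4 * m + 3) (2 * m + 1) m D"
    using assms(4) by (simp add: paley_type_def n add.commute)
  then have fin: "finite (carrier G)" and card_G: "card (carrier G) = 4 * m + 3"
    and D: "D \<subseteq> carrier G" and card_D: "card D = 2 * m + 1"
    and right: "\<And>g. g \<in> carrier G \<Longrightarrow> g \<noteq> \<one>\<^bsub>G\<^esub> \<Longrightarrow>
      card {(x, x'). x \<in> D \<and> x' \<in> D \<and> x \<otimes>\<^bsub>G\<^esub> inv\<^bsub>G\<^esub> x' = g} = m"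
    by (auto simp: difference_set_def order_def)
  let ?P = "D \<times> D \<union> off_diagonal (carrier G - D)"
  have P: "?P \<subseteq> carrier G \<times> carrier G"
    using D by (auto simp: off_diagonal_eq)
  \<comment> \<open>\<open>(2 * m + 1) * (2 * m + 1) + (2 * m + 2) * (2 * m + 1)\<close>, with the
    common factor \<open>2 * m + 1\<close>.\<close>
  have "card ?P = (4 * m + 3) * (2 * m + 1)"
    unfolding card_square_Un_off_diagonal[OF fin D] card_G card_D by (simp add: algebra_simps)
  moreover have
    "card {((x, y), (x', y')). (x, y) \<in> ?P \<and> (x', y') \<in> ?P \<and>
       inv\<^bsub>G\<^esub> x \<otimes>\<^bsub>G\<^esub> x' = g \<and> inv\<^bsub>G\<^esub> y \<otimes>\<^bsub>G\<^esub> y' = g} = (4 * m + 3) * m" (is "card ?S1 = _")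
    "card {((x, y), (x', y')). (x, y) \<in> ?P \<and> (x', y') \<in> ?P \<and>
       x \<otimes>\<^bsub>G\<^esub> inv\<^bsub>G\<^esub> x' = g \<and> y = y'} = (4 * m + 3) * m" (is "card ?S2 = _")
    "card {((x, y), (x', y')). (x, y) \<in> ?P \<and> (x', y') \<in> ?P \<and>
       x = x' \<and> y \<otimes>\<^bsub>G\<^esub> inv\<^bsub>G\<^esub> y' = g} = (4 * m + 3) * m" (is "card ?S3 = _")
    if g: "g \<in> carrier G" "g \<noteq> \<one>\<^bsub>G\<^esub>" for g
  proof -
    \<comment> \<open>Named relations keep \<open>auto\<close> from eliminating \<open>g\<close> by substitution.\<close>
    define Lq Rq where "Lq x x' \<longleftrightarrow> inv\<^bsub>G\<^esub> x \<otimes>\<^bsub>G\<^esub> x' = g"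
      and "Rq x x' \<longleftrightarrow> x \<otimes>\<^bsub>G\<^esub> inv\<^bsub>G\<^esub> x' = g" for x x'
    have Lq: "Lq x x' \<longleftrightarrow> x' = x \<otimes>\<^bsub>G\<^esub> g" and Rq: "Rq x x' \<longleftrightarrow> x = g \<otimes>\<^bsub>G\<^esub> x'"
      if "x \<in> carrier G" "x' \<in> carrier G" for x x'
      unfolding Lq_def Rq_def using that g(1) by (metis inv_solve_left, metis inv_solve_right)
    \<comment> \<open>Right translation matches quotients \<open>inv x \<otimes> x'\<close>, so this
      count needs the variance argument; the one for left translation is the definition of a
      difference set.\<close>
    have card_right: "card {x \<in> D. x \<otimes>\<^bsub>G\<^esub> g \<in> D} = m"
    proof -
      have "bij_betw (\<lambda>x. (x, x \<otimes>\<^bsub>G\<^esub> g)) {x \<in> D. x \<otimes>\<^bsub>G\<^esub> g \<in> D}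
          {p \<in> D \<times> D. inv\<^bsub>G\<^esub> (fst p) \<otimes>\<^bsub>G\<^esub> snd p = g}"
        unfolding Lq_def[symmetric] Rq_def[symmetric]
        by (rule bij_betw_byWitness[where f' = fst]) (use D in \<open>auto simp: Lq subset_iff\<close>)
      from bij_betw_same_card[OF this] difference_set_left_quotients[OF ds g] show ?thesis
        by (rule trans)
    qed
    have card_left: "card {x \<in> D. g \<otimes>\<^bsub>G\<^esub> x \<in> D} = m"
    proof -
      have "bij_betw (\<lambda>x. (g \<otimes>\<^bsub>G\<^esub> x, x)) {x \<in> D. g \<otimes>\<^bsub>G\<^esub> x \<in> D}
          {(x, x'). x \<in> D \<and> x' \<in> D \<and> x \<otimes>\<^bsub>G\<^esub> inv\<^bsub>G\<^esub> x' = g}"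
        unfolding Lq_def[symmetric] Rq_def[symmetric]
        by (rule bij_betw_byWitness[where f' = snd]) (use D in \<open>auto simp: Rq subset_iff\<close>)
      from bij_betw_same_card[OF this] right[OF g] show ?thesis
        by (rule trans)
    qed
    have bij_right: "bij_betw (\<lambda>x. x \<otimes>\<^bsub>G\<^esub> g) (carrier G) (carrier G)"
      by (rule bij_betw_byWitness[where f' = "\<lambda>x. x \<otimes>\<^bsub>G\<^esub> inv\<^bsub>G\<^esub> g"]) (use g in \<open>auto simp: m_assoc\<close>)
    have bij_left: "bij_betw (\<lambda>x. g \<otimes>\<^bsub>G\<^esub> x) (carrier G) (carrier G)"
      by (rule bij_betw_byWitness[where f' = "\<lambda>x. inv\<^bsub>G\<^esub> g \<otimes>\<^bsub>G\<^esub> x"]) (use g in \<open>auto simp: m_assoc[symmetric]\<close>)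
    interpret r: shifted_paley_set "carrier G" D m "\<lambda>x. x \<otimes>\<^bsub>G\<^esub> g"
      using fin card_G D card_D bij_right card_right g by unfold_locales auto
    interpret l: shifted_paley_set "carrier G" D m "\<lambda>x. g \<otimes>\<^bsub>G\<^esub> x"
      using fin card_G D card_D bij_left card_left g by unfold_locales auto
    \<comment> \<open>In the first condition the second point is the right translate of the first,
      so \<open>fst\<close> recovers the pair.\<close>
    have "bij_betw (\<lambda>(x, y). ((x, y), (x \<otimes>\<^bsub>G\<^esub> g, y \<otimes>\<^bsub>G\<^esub> g)))
        {(x, y) \<in> ?P. (x \<otimes>\<^bsub>G\<^esub> g, y \<otimes>\<^bsub>G\<^esub> g) \<in> ?P} ?S1"
      unfolding Lq_def[symmetric] Rq_def[symmetric]
      by (rule bij_betw_byWitness[where f' = fst])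
        (use D in \<open>auto simp: Lq subset_iff off_diagonal_eq\<close>)
    from bij_betw_same_card[OF this, symmetric] r.card_shift_both show "card ?S1 = (4 * m + 3) * m"
      by (rule trans)
    \<comment> \<open>In the other two conditions the first point is the left translate of the
      second in one coordinate, so the pair is recovered by \<open>snd\<close>.\<close>
    have "bij_betw (\<lambda>(x, y). ((g \<otimes>\<^bsub>G\<^esub> x, y), (x, y))) {(x, y) \<in> ?P. (g \<otimes>\<^bsub>G\<^esub> x, y) \<in> ?P} ?S2"
      unfolding Lq_def[symmetric] Rq_def[symmetric]
      by (rule bij_betw_byWitness[where f' = snd])
        (use D in \<open>auto simp: Rq subset_iff off_diagonal_eq\<close>)
    from bij_betw_same_card[OF this, symmetric] l.card_shift_fst show "card ?S2 = (4 * m + 3) * m"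
      by (rule trans)
    have "bij_betw (\<lambda>(x, y). ((x, g \<otimes>\<^bsub>G\<^esub> y), (x, y))) {(x, y) \<in> ?P. (x, g \<otimes>\<^bsub>G\<^esub> y) \<in> ?P} ?S3"
      unfolding Lq_def[symmetric] Rq_def[symmetric]
      by (rule bij_betw_byWitness[where f' = snd])
        (use D in \<open>auto simp: Rq subset_iff off_diagonal_eq\<close>)
    from bij_betw_same_card[OF this, symmetric] l.card_shift_snd show "card ?S3 = (4 * m + 3) * m"
      by (rule trans)
  qed
  moreover have "4 * n - 1 = 4 * m + 3" "2 * n - 1 = 2 * m + 1" "n - 1 = m"
    by (simp_all add: n)
  ultimately show ?thesis
    unfolding difference_set_propriety_3_def
    using fin card_G P is_group by (simp add: order_def)
qed

end
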